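(* Let $\Gamma\subseteq\Sigma$, $\Delta=\Sigma\setminus\Gamma$, and let $\mathcal A=(Q,\Sigma,\delta,q_0,F)$ be a permutation automaton. Set $N=\{\delta_u:Q\to Q\mid u\in\Delta^*\}$, the subgroup of $\mathcal T_{\mathcal A}$ generated by $\Delta$. If $N$ is normal in $\mathcal T_{\mathcal A}$, then $\mathcal A$ is a state-partition automaton for $\pi_\Gamma$. Hence, in this case, $\pi_\Gamma(L(\mathcal A))$ is recognizable by an automaton (DFA) with at most $|Q|$ states.
   Context: A (partial) deterministic finite automaton (DFA) is a quintuple $\mathcal A=(Q,\Sigma,\delta,q_0,F)$ with finite state set $Q$, finite alphabet $\Sigma$, partial transition function $\delta:Q\times\Sigma\to Q$ (extended to words in the usual way), start state $q_0\in Q$ and final states $F\subseteq Q$; $L(\mathcal A)=\{u\in\Sigma^*\mid \delta(q_0,u)\text{ is defined and in }F\}$. A permutation automaton is a DFA in which, for every letter $x\in\Sigma$, the map $q\mapsto\delta(q,x)$ is a (totally defined) bijection of $Q$. For $u\in\Sigma^*$, $\delta_u:Q\to Q$ is $\delta_u(q)=\delta(q,u)$ (so in $\delta_{uv}$ the word $u$ acts first), and $\mathcal T_{\mathcal A}=\{\delta_u\mid u\in\Sigma^*\}$, which is a finite group of permutations when $\mathcal A$ is a permutation automaton. A subgroup $N$ of $\mathcal T_{\mathcal A}$ is normal if for all $u,v\in\Sigma^*$: there is $\delta_w\in N$ with $\delta_u=\delta_{wv}$ if and only if there is $\delta_{w'}\in N$ with $\delta_u=\delta_{vw'}$. For $\Gamma\subseteq\Sigma$,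 the projection $\pi_\Gamma:\Sigma^*\to\Gamma^*$ is the monoid homomorphism with $\pi_\Gamma(x)=x$ for $x\in\Gamma$ and $\pi_\Gamma(x)=\varepsilon$ for $x\in\Sigma\setminus\Gamma$. For $\Sigma'\subseteq\Sigma$ and $S\subseteq Q$, $\operatorname{Orb}_{\Sigma'}(S)=\{\delta(q,u)\mid q\in S,\ u\in\Sigma'^*,\ \delta(q,u)\text{ defined}\}$ and $\operatorname{Orb}_{\Sigma'}(q)=\operatorname{Orb}_{\Sigma'}(\{q\})$. With $\Delta=\Sigma\setminus\Gamma$, the projection automaton of $\mathcal A$ for $\Gamma$ is $\mathcal R_{\mathcal A}^\Gamma=(\mathcal P(Q),\Gamma,\mu,\operatorname{Orb}_\Delta(q_0),E)$ with $\mu(S,x)=\operatorname{Orb}_\Delta(\delta(S,x))$ for $S\subseteq Q$, $x\in\Gamma$, where $\delta(S,x)=\{\delta(s,x)\mid s\in S,\ \delta(s,x)\text{ defined}\}$, and $E=\{T\subseteq Q\mid T\cap F\ne\emptyset\}$. $\mathcal A$ is a state-partition automaton for $\pi_\Gamma$ if the states of $\mathcal R_{\mathcal A}^\Gamma$ reachable from its start state $\operatorname{Orb}_\Delta(q_0)$ form a partition of $Q$.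
   Formalization: That the automaton is a state-partition automaton is stated for automata whose states are all reachable from the start state; otherwise it fails (two states, all letters acting as the identity). The bound of |Q| states is stated without this assumption. *)

theory Defs
  imports "HOL-Algebra.Generated_Groups" "HOL-Library.Disjoint_Sets"
begin

record ('q, 'a) automaton =
  states :: "'q set"
  alphabet :: "'a set"
  delta :: "'q \<times> 'a \<rightharpoonup> 'q"
  start :: 'q
  finals :: "'q set"

definition dfa :: "('q, 'a) automaton \<Rightarrow> bool" where
  "dfa A \<longleftrightarrow>
     finite (states A) \<and> finite (alphabet A) \<and>
     dom (delta A) \<subseteq> states A \<times> alphabet A \<and> ran (delta A) \<subseteq> states A \<and>
     start A \<in> states A \<and> finals A \<subseteq> states A"

fun run :: "('q, 'a) automaton \<Rightarrow> 'q \<Rightarrow> 'a list \<Rightarrow> 'q option" where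
  "run A q [] = Some q"
| "run A q (x # u) = Option.bind (delta A (q, x)) (\<lambda>p. run A p u)"

definition language :: "('q, 'a) automaton \<Rightarrow> 'a list set" where
  "language A = {u \<in> lists (alphabet A). \<exists>q \<in> finals A. run A (start A) u = Some q}"

definition permutation_automaton :: "('q, 'a) automaton \<Rightarrow> bool" where
  "permutation_automaton A \<longleftrightarrow>
     dfa A \<and>
     (\<forall>x \<in> alphabet A.
        (\<forall>q \<in> states A. delta A (q, x) \<noteq> None) \<and>
        bij_betw (\<lambda>q. the (delta A (q, x))) (states A) (states A))"

text \<open>The map \<open>\<delta>\<^sub>u\<close>, as a partial map that is undefined outside the state set, so that
  equality of such maps is equality of functions on the states.\<close>

definition word_map :: "('q, 'a) automaton \<Rightarrow> 'a list \<Rightarrow> 'q \<rightharpoonup> 'q" where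
  "word_map A u = (\<lambda>q. run A q u) |` states A"

text \<open>The product is written in the order of the words (the left factor acts first), so that
  \<open>\<delta>\<^sub>u \<otimes> \<delta>\<^sub>v = \<delta>\<^sub>u\<^sub>v\<close>.\<close>

definition transition_group :: "('q, 'a) automaton \<Rightarrow> ('q \<rightharpoonup> 'q) monoid" where
  "transition_group A =
     \<lparr>carrier = word_map A ` lists (alphabet A),
      mult = (\<lambda>f g. g \<circ>\<^sub>m f),
      one = word_map A []\<rparr>"

definition projection :: "'a set \<Rightarrow> 'a list \<Rightarrow> 'a list" where
  "projection \<Gamma> = filter (\<lambda>x. x \<in> \<Gamma>)"

definition orbit :: "('q, 'a) automaton \<Rightarrow> 'a set \<Rightarrow> 'q set \<Rightarrow> 'q set" where
  "orbit A X S = {p. \<exists>q \<in> S. \<exists>u \<in> lists X. run A q u = Some p}"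

definition accessible :: "('q, 'a) automaton \<Rightarrow> bool" where
  "accessible A \<longleftrightarrow> orbit A (alphabet A) {start A} = states A"

definition projection_automaton ::
  "('q, 'a) automaton \<Rightarrow> 'a set \<Rightarrow> ('q set, 'a) automaton" where
  "projection_automaton A \<Gamma> =
     (let \<Delta> = alphabet A - \<Gamma> in
      \<lparr>states = Pow (states A),
       alphabet = \<Gamma>,
       delta = (\<lambda>(S, x).
         if S \<subseteq> states A \<and> x \<in> \<Gamma>
         then Some (orbit A \<Delta> {p. \<exists>s \<in> S. delta A (s, x) = Some p})
         else None),
       start = orbit A \<Delta> {start A},
       finals = {T. T \<subseteq> states A \<and> T \<inter> finals A \<noteq> {}}\<rparr>)"

definition state_partition_automaton :: "('q, 'a) automaton \<Rightarrow> 'a set \<Rightarrow> bool" where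
  "state_partition_automaton A \<Gamma> \<longleftrightarrow>
     (let R = projection_automaton A \<Gamma>
      in partition_on (states A) (orbit R (alphabet R) {start R}))"

text \<open>For a permutation automaton, the structure \<^const>\<open>transition_group\<close> is a group, the words
  over any subalphabet induce a subgroup of it, which is the one generated by the letters of that
  subalphabet, and normality of such a subgroup is the commutation of the two kinds of cosets,
  expressed with words.\<close>

lemma run_append: "run A q (u @ v) = Option.bind (run A q u) (\<lambda>p. run A p v)"
  by (induction u arbitrary: q) (auto simp: Option.bind_assoc split: Option.bind_splits)

lemma delta_in_states: "dfa A \<Longrightarrow> delta A (q, x) = Some r \<Longrightarrow> r \<in> states A"
  by (auto simp: dfa_def ran_def)

lemma perm_delta:
  assumes "permutation_automaton A" "x \<in> alphabet A" "q \<in> states A"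
  obtains r where "delta A (q, x) = Some r" "r \<in> states A"
proof -
  have "dfa A" "delta A (q, x) \<noteq> None"
    using assms by (auto simp: permutation_automaton_def)
  then show thesis
    using that delta_in_states by fastforce
qed

lemma run_in_states:
  assumes "dfa A" "q \<in> states A" "run A q u = Some p"
  shows "p \<in> states A"
  using assms(2,3)
proof (induction u arbitrary: q rule: list.induct)
  case (Cons x u)
  then obtain r where r: "delta A (q, x) = Some r" "run A r u = Some p"
    by (auto simp: bind_eq_Some_conv)
  then have "r \<in> states A"
    using delta_in_states[OF assms(1)] by blast
  then show ?case
    using Cons.IH r(2) by blast
qed simp

lemma word_map_append:
  assumes "dfa A"
  shows "word_map A (u @ v) = word_map A v \<circ>\<^sub>m word_map A u"
proof
  fix q
  show "word_map A (u @ v) q = (word_map A v \<circ>\<^sub>m word_map A u) q"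
  proof (cases "q \<in> states A")
    case True
    then show ?thesis
      using run_in_states[OF assms True, of u]
      by (cases "run A q u") (auto simp: word_map_def run_append map_comp_def restrict_map_def)
  qed (auto simp: word_map_def map_comp_def)
qed

lemma run_perm_total:
  assumes "permutation_automaton A" "u \<in> lists (alphabet A)" "q \<in> states A"
  shows "\<exists>p \<in> states A. run A q u = Some p"
  using assms(2,3)
proof (induction u arbitrary: q rule: list.induct)
  case (Cons x u)
  then obtain r where "delta A (q, x) = Some r" "r \<in> states A"
    using perm_delta[OF assms(1)] by (metis Cons_in_lists_iff)
  then show ?case
    using Cons by auto
qed simp

lemma run_perm_inj:
  assumes "permutation_automaton A" "u \<in> lists (alphabet A)"
    "q \<in> states A" "q' \<in> states A" "run A q u = run A q' u"
  shows "q = q'"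
  using assms(2,3,4,5)
proof (induction u arbitrary: q q' rule: list.induct)
  case (Cons x u)
  have x: "x \<in> alphabet A" and u: "u \<in> lists (alphabet A)"
    using Cons.prems(1) by auto
  obtain r where r: "delta A (q, x) = Some r" "r \<in> states A"
    using perm_delta[OF assms(1) x Cons.prems(2)] .
  obtain r' where r': "delta A (q', x) = Some r'" "r' \<in> states A"
    using perm_delta[OF assms(1) x Cons.prems(3)] .
  have "r = r'"
    using Cons.IH[OF u r(2) r'(2)] Cons.prems(4) r r' by simp
  moreover have "inj_on (\<lambda>q. the (delta A (q, x))) (states A)"
    using assms(1) x by (simp add: permutation_automaton_def bij_betw_def)
  ultimately show ?case
    using r r' Cons.prems(2,3) by (simp add: inj_on_def)
qed simp

lemma finite_word_maps:
  assumes "dfa A"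
  shows "finite (word_map A ` W)"
proof -
  have "word_map A ` W \<subseteq> {m. dom m \<subseteq> states A \<and> ran m \<subseteq> states A}"
    using run_in_states[OF assms]
    by (auto simp: word_map_def ran_def restrict_map_def split: if_splits)
  moreover have "{m. dom m \<subseteq> states A \<and> ran m \<subseteq> states A} =
      (\<Union>D \<in> Pow (states A). {m. dom m = D \<and> ran m \<subseteq> states A})"
    by auto
  moreover have "finite (\<Union>D \<in> Pow (states A). {m. dom m = D \<and> ran m \<subseteq> states A})"
    using assms finite_subset by (auto simp: dfa_def intro!: finite_set_of_finite_maps)
  ultimately show ?thesis
    using finite_subset by metis
qed

lemma word_map_left_inverse:
  assumes "permutation_automaton A" "X \<subseteq> alphabet A" "u \<in> lists X"
  shows "\<exists>v \<in> lists X. word_map A (v @ u) = word_map A []"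
proof -
  have dfa: "dfa A" using assms(1) by (simp add: permutation_automaton_def)
  let ?M = "word_map A ` lists X"
  have u: "u \<in> lists (alphabet A)" using assms(2,3) by auto
  have "inj_on (\<lambda>g. word_map A u \<circ>\<^sub>m g) ?M"
  proof (rule inj_onI)
    fix g h
    assume "g \<in> ?M" "h \<in> ?M" and eq: "word_map A u \<circ>\<^sub>m g = word_map A u \<circ>\<^sub>m h"
    then obtain v w where v: "v \<in> lists (alphabet A)" "g = word_map A v"
      and w: "w \<in> lists (alphabet A)" "h = word_map A w"
      using assms(2) by blast
    show "g = h"
    proof
      fix q
      show "g q = h q"
      proof (cases "q \<in> states A")
        case True
        obtain p p' where p: "p \<in> states A" "run A q v = Some p"
          and p': "p' \<in> states A" "run A q w = Some p'"
          using run_perm_total[OF assms(1) v(1) True] run_perm_total[OF assms(1) w(1) True] by blast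
        have "run A p u = run A p' u"
          using fun_cong[OF eq, of q] p p' True v w by (simp add: word_map_def)
        then show ?thesis
          using run_perm_inj[OF assms(1) u p(1) p'(1)] p p' v w True by (simp add: word_map_def)
      qed (simp add: v w word_map_def)
    qed
  qed
  moreover have "(\<lambda>g. word_map A u \<circ>\<^sub>m g) ` ?M \<subseteq> ?M"
  proof (rule image_subsetI)
    fix g assume "g \<in> ?M"
    then obtain v where v: "v \<in> lists X" "g = word_map A v" by blast
    then have "v @ u \<in> lists X" using assms(3) by auto
    then show "word_map A u \<circ>\<^sub>m g \<in> ?M"
      unfolding v(2) word_map_append[OF dfa, symmetric] by blast
  qed
  ultimately have "(\<lambda>g. word_map A u \<circ>\<^sub>m g) ` ?M = ?M"
    by (intro endo_inj_surj finite_word_maps[OF dfa])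
  moreover have "word_map A [] \<in> ?M" by blast
  ultimately have "word_map A [] \<in> (\<lambda>g. word_map A u \<circ>\<^sub>m g) ` ?M" by (simp only:)
  then obtain v where "v \<in> lists X" "word_map A [] = word_map A u \<circ>\<^sub>m word_map A v"
    by blast
  then show ?thesis
    by (metis word_map_append[OF dfa])
qed

lemma mult_word_map:
  assumes "dfa A"
  shows "word_map A u \<otimes>\<^bsub>transition_group A\<^esub> word_map A v = word_map A (u @ v)"
  by (simp add: transition_group_def word_map_append[OF assms])

lemma group_transition_group:
  assumes "permutation_automaton A"
  shows "group (transition_group A)"
proof -
  have dfa: "dfa A" using assms by (simp add: permutation_automaton_def)
  have carr: "carrier (transition_group A) = word_map A ` lists (alphabet A)"
    and one: "\<one>\<^bsub>transition_group A\<^esub> = word_map A []"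
    by (simp_all add: transition_group_def)
  note m = mult_word_map[OF dfa]
  show ?thesis
  proof (rule groupI)
    fix x assume "x \<in> carrier (transition_group A)"
    then obtain u where u: "u \<in> lists (alphabet A)" "x = word_map A u"
      by (auto simp: carr)
    then obtain v where "v \<in> lists (alphabet A)" "word_map A (v @ u) = word_map A []"
      using word_map_left_inverse[OF assms] by blast
    then show "\<exists>y \<in> carrier (transition_group A). y \<otimes>\<^bsub>transition_group A\<^esub> x = \<one>\<^bsub>transition_group A\<^esub>"
      using u by (auto simp: carr one m)
  next
    fix x y assume "x \<in> carrier (transition_group A)" "y \<in> carrier (transition_group A)"
    then obtain u v where "u \<in> lists (alphabet A)" "x = word_map A u"
      "v \<in> lists (alphabet A)" "y = word_map A v"
      unfolding carr by blast
    then show "x \<otimes>\<^bsub>transition_group A\<^esub> y \<in> carrier (transition_group A)"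
      unfolding carr by (auto simp: m intro!: imageI)
  next
    show "\<one>\<^bsub>transition_group A\<^esub> \<in> carrier (transition_group A)"
      unfolding carr one by blast
  qed (auto simp: carr one m)
qed

lemma subgroup_word_maps:
  assumes "permutation_automaton A" "X \<subseteq> alphabet A"
  shows "subgroup (word_map A ` lists X) (transition_group A)"
proof -
  have dfa: "dfa A" using assms by (simp add: permutation_automaton_def)
  interpret group "transition_group A" by (rule group_transition_group[OF assms(1)])
  have carr: "carrier (transition_group A) = word_map A ` lists (alphabet A)"
    and one: "\<one>\<^bsub>transition_group A\<^esub> = word_map A []"
    by (simp_all add: transition_group_def)
  note m = mult_word_map[OF dfa]
  show ?thesis
  proof (rule subgroupI)
    show "word_map A ` lists X \<subseteq> carrier (transition_group A)"
      using assms(2) by (auto simp: carr)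
    fix x assume "x \<in> word_map A ` lists X"
    then obtain u where u: "u \<in> lists X" "x = word_map A u" by blast
    then obtain v where v: "v \<in> lists X" "word_map A (v @ u) = word_map A []"
      using word_map_left_inverse[OF assms] by blast
    have "u \<in> lists (alphabet A)" "v \<in> lists (alphabet A)" using u v assms(2) by auto
    then have "inv\<^bsub>transition_group A\<^esub> x = word_map A v"
      using u v by (intro inv_equality) (auto simp: m one carr)
    then show "inv\<^bsub>transition_group A\<^esub> x \<in> word_map A ` lists X" using v by blast
  next
    fix x y assume "x \<in> word_map A ` lists X" "y \<in> word_map A ` lists X"
    then obtain u v where "u \<in> lists X" "x = word_map A u" "v \<in> lists X" "y = word_map A v"
      by blast
    then show "x \<otimes>\<^bsub>transition_group A\<^esub> y \<in> word_map A ` lists X"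
      by (auto simp: m intro!: imageI)
  qed blast
qed

lemma word_maps_eq_generate:
  assumes "permutation_automaton A" "X \<subseteq> alphabet A"
  shows "word_map A ` lists X = generate (transition_group A) ((\<lambda>x. word_map A [x]) ` X)"
proof
  have dfa: "dfa A" using assms by (simp add: permutation_automaton_def)
  interpret group "transition_group A" by (rule group_transition_group[OF assms(1)])
  show "generate (transition_group A) ((\<lambda>x. word_map A [x]) ` X) \<subseteq> word_map A ` lists X"
    by (intro generate_subgroup_incl subgroup_word_maps[OF assms]) auto
  have "word_map A u \<in> generate (transition_group A) ((\<lambda>x. word_map A [x]) ` X)"
    if "u \<in> lists X" for u
    using that
  proof (induction u)
    case Nil
    show ?case
      using generate.one[of "transition_group A"] by (simp add: transition_group_def)
  next
    case (Cons x u)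
    then have "word_map A [x] \<otimes>\<^bsub>transition_group A\<^esub> word_map A u
        \<in> generate (transition_group A) ((\<lambda>x. word_map A [x]) ` X)"
      by (intro generate.eng) (auto intro: generate.incl)
    then show ?case by (simp add: mult_word_map[OF dfa])
  qed
  then show "word_map A ` lists X \<subseteq> generate (transition_group A) ((\<lambda>x. word_map A [x]) ` X)"
    by blast
qed

lemma normal_transition_group_iff:
  assumes "permutation_automaton A" "subgroup N (transition_group A)"
  shows "N \<lhd> transition_group A \<longleftrightarrow>
    (\<forall>u \<in> lists (alphabet A). \<forall>v \<in> lists (alphabet A).
       (\<exists>w \<in> lists (alphabet A). word_map A w \<in> N \<and> word_map A u = word_map A (w @ v)) \<longleftrightarrow>
       (\<exists>w' \<in> lists (alphabet A). word_map A w' \<in> N \<and> word_map A u = word_map A (v @ w')))"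
    (is "_ \<longleftrightarrow> ?R")
proof -
  let ?G = "transition_group A"
  have dfa: "dfa A" using assms by (simp add: permutation_automaton_def)
  interpret group ?G by (rule group_transition_group[OF assms(1)])
  have carr: "carrier ?G = word_map A ` lists (alphabet A)"
    by (simp add: transition_group_def)
  have N: "N \<subseteq> word_map A ` lists (alphabet A)"
    using subgroup.subset[OF assms(2)] carr by simp
  have R: "(\<exists>w \<in> lists (alphabet A). word_map A w \<in> N \<and> f = word_map A (w @ v))
      \<longleftrightarrow> f \<in> N #>\<^bsub>?G\<^esub> word_map A v" for f v
    unfolding r_coset_def mult_word_map[OF dfa, symmetric] using N by blast
  have L: "(\<exists>w \<in> lists (alphabet A). word_map A w \<in> N \<and> f = word_map A (v @ w))
      \<longleftrightarrow> f \<in> word_map A v <#\<^bsub>?G\<^esub> N" for f v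
    unfolding l_coset_def mult_word_map[OF dfa, symmetric] using N by blast
  have sub: "N #>\<^bsub>?G\<^esub> g \<subseteq> carrier ?G" "g <#\<^bsub>?G\<^esub> N \<subseteq> carrier ?G" if "g \<in> carrier ?G" for g
    using that subgroup.subset[OF assms(2)] r_coset_subset_G l_coset_subset_G by blast+
  have "N \<lhd> ?G \<longleftrightarrow> (\<forall>g \<in> carrier ?G. N #>\<^bsub>?G\<^esub> g = g <#\<^bsub>?G\<^esub> N)"
    using assms(2) by (simp add: normal_def normal_axioms_def is_group)
  also have "\<dots> \<longleftrightarrow> (\<forall>f \<in> carrier ?G. \<forall>g \<in> carrier ?G. f \<in> N #>\<^bsub>?G\<^esub> g \<longleftrightarrow> f \<in> g <#\<^bsub>?G\<^esub> N)"
    using sub by blast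
  also have "\<dots> \<longleftrightarrow> ?R"
    unfolding R L carr by blast
  finally show ?thesis .
qed

text \<open>Only an accessible automaton can be a state-partition automaton: the reachable states of
  the projection automaton cover no state that is unreachable in the original automaton.\<close>

lemma orbit_trans:
  assumes "S \<subseteq> orbit A (alphabet A) {q}" "X \<subseteq> alphabet A"
  shows "orbit A X S \<subseteq> orbit A (alphabet A) {q}"
proof
  fix p assume "p \<in> orbit A X S"
  then obtain r v where rv: "r \<in> S" "v \<in> lists X" "run A r v = Some p"
    unfolding orbit_def by blast
  then obtain u where u: "u \<in> lists (alphabet A)" "run A q u = Some r"
    using assms(1) unfolding orbit_def by blast
  have "u @ v \<in> lists (alphabet A)" using u(1) rv(2) assms(2) by auto
  moreover have "run A q (u @ v) = Some p" using u(2) rv(3) by (simp add: run_append)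
  ultimately show "p \<in> orbit A (alphabet A) {q}" unfolding orbit_def by blast
qed

lemma run_projection_automaton_subset:
  assumes "\<Gamma> \<subseteq> alphabet A" "S \<subseteq> orbit A (alphabet A) {q}"
    "run (projection_automaton A \<Gamma>) S w = Some T"
  shows "T \<subseteq> orbit A (alphabet A) {q}"
  using assms(2,3)
proof (induction w arbitrary: S rule: list.induct)
  case (Cons x w)
  let ?S = "{p. \<exists>s \<in> S. delta A (s, x) = Some p}"
  have x: "x \<in> \<Gamma>" and run: "run (projection_automaton A \<Gamma>) (orbit A (alphabet A - \<Gamma>) ?S) w = Some T"
    using Cons.prems(2)
    by (auto simp: projection_automaton_def Let_def bind_eq_Some_conv split: if_splits)
  have "?S \<subseteq> orbit A {x} S"
  proof
    fix p assume "p \<in> ?S"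
    then obtain s where "s \<in> S" "run A s [x] = Some p" by auto
    moreover have "[x] \<in> lists {x}" by simp
    ultimately show "p \<in> orbit A {x} S" unfolding orbit_def by blast
  qed
  also have "\<dots> \<subseteq> orbit A (alphabet A) {q}"
    using Cons.prems(1) x assms(1) by (intro orbit_trans) auto
  finally have "orbit A (alphabet A - \<Gamma>) ?S \<subseteq> orbit A (alphabet A) {q}"
    by (intro orbit_trans) auto
  then show ?case using Cons.IH run by blast
qed simp

lemma state_partition_automaton_imp_accessible:
  assumes "dfa A" "\<Gamma> \<subseteq> alphabet A" "state_partition_automaton A \<Gamma>"
  shows "accessible A"
proof -
  let ?R = "projection_automaton A \<Gamma>"
  have "start A \<in> orbit A (alphabet A) {start A}"
    using run.simps(1)[of A "start A"] lists.Nil[of "alphabet A"] unfolding orbit_def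
    by (intro CollectI bexI[of _ "start A"] bexI[of _ "[]"]) simp_all
  then have *: "start ?R \<subseteq> orbit A (alphabet A) {start A}"
    using orbit_trans[of "{start A}" A "start A" "alphabet A - \<Gamma>"]
    by (simp add: projection_automaton_def Let_def)
  have "T \<subseteq> orbit A (alphabet A) {start A}" if T: "T \<in> orbit ?R (alphabet ?R) {start ?R}" for T
  proof -
    obtain w where "run ?R (start ?R) w = Some T"
      using T unfolding orbit_def by blast
    then show ?thesis
      using run_projection_automaton_subset[OF assms(2) *] by blast
  qed
  moreover have "states A = \<Union>(orbit ?R (alphabet ?R) {start ?R})"
    using assms(3) by (simp add: state_partition_automaton_def Let_def partition_on_def)
  ultimately have "states A \<subseteq> orbit A (alphabet A) {start A}" by blast
  moreover have "orbit A (alphabet A) {start A} \<subseteq> states A"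
    using run_in_states[OF assms(1)] assms(1) by (auto simp: orbit_def dfa_def)
  ultimately show ?thesis by (simp add: accessible_def)
qed

end

theory Submission
  imports Defs "HOL-Library.Countable_Set"
begin

text \<open>Normality of \<open>N\<close> says that \<open>N\<close> permutes its own orbits compatibly with every letter:
  a path labelled \<open>w x\<close> with \<open>w \<in> \<Delta>\<^sup>*\<close> has the same effect as one labelled \<open>x w'\<close>
  with \<open>w' \<in> \<Delta>\<^sup>*\<close>. Hence \<open>x\<close> maps the \<open>N\<close>-orbit of \<open>q\<close> into that of \<open>\<delta>(q, x)\<close>, so
  reading a word \<open>u\<close> takes the automaton \<open>A\<close> from \<open>q\<close> to \<open>\<delta>(q, u)\<close> and the projection automaton
  from the orbit of \<open>q\<close> to the orbit of \<open>\<delta>(q, u)\<close>. The reachable states of the latter are thus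
  \<open>N\<close>-orbits, which are disjoint because \<open>N\<close> is a group, and there are at most \<open>|Q|\<close> of them.\<close>

section \<open>Renaming the states as natural numbers\<close>

text \<open>Counts states over a closed set \<open>P\<close> instead of \<open>states C\<close>: the
  projection automaton carries the whole power set as its states, whereas its runs stay among the
  orbits.\<close>

lemma nat_dfa_of_closed_states:
  fixes C :: "('s, 'a) automaton"
  assumes fin: "finite P" "finite (alphabet C)"
    and start: "start C \<in> P"
    and closed: "\<And>p x r. p \<in> P \<Longrightarrow> x \<in> alphabet C \<Longrightarrow> delta C (p, x) = Some r \<Longrightarrow> r \<in> P"
  shows "\<exists>B :: (nat, 'a) automaton.
    dfa B \<and> alphabet B = alphabet C \<and> card (states B) = card P \<and> language B = language C"
proof -
  define f where "f = to_nat_on P"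
  have inj: "inj_on f P"
    unfolding f_def using fin(1) by (intro inj_on_to_nat_on countable_finite)
  \<comment> \<open>The coding \<open>f\<close> is injective only on \<open>P\<close>, so the final
    states are cut down to \<open>P\<close> before coding; a final state outside \<open>P\<close>
    might share its code with a non-final one.\<close>
  define B :: "(nat, 'a) automaton" where
    "B = \<lparr>states = f ` P, alphabet = alphabet C,
      delta = (\<lambda>(n, x). if n \<in> f ` P \<and> x \<in> alphabet C
        then map_option f (delta C (inv_into P f n, x)) else None),
      start = f (start C), finals = f ` (P \<inter> finals C)\<rparr>"
  have delta: "delta B (f p, x) = map_option f (delta C (p, x))"
    if "p \<in> P" "x \<in> alphabet C" for p x
    using that inj by (simp add: B_def)
  have "dfa B"
    unfolding dfa_def
  proof (intro conjI)
    show "ran (delta B) \<subseteq> states B"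
    proof
      fix m assume "m \<in> ran (delta B)"
      then obtain n x where nx: "delta B (n, x) = Some m"
        by (auto simp: ran_def)
      then obtain p where p: "n = f p" "p \<in> P" "x \<in> alphabet C"
        by (auto simp: B_def split: if_splits)
      then obtain r where "delta C (p, x) = Some r" "m = f r"
        using nx delta by auto
      then show "m \<in> states B"
        using p closed by (simp add: B_def)
    qed
  qed (use fin start in \<open>auto simp: B_def split: if_splits\<close>)
  \<comment> \<open>Staying in \<open>P\<close> is proved along with the simulation, since the
    acceptance argument needs injectivity of \<open>f\<close> at the state reached.\<close>
  moreover have run: "run B (f p) u = map_option f (run C p u) \<and> (\<forall>r. run C p u = Some r \<longrightarrow> r \<in> P)"
    if "p \<in> P" "u \<in> lists (alphabet C)" for p u
    using that
  proof (induction u arbitrary: p rule: list.induct)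
    case (Cons x u)
    then have p: "p \<in> P" and x: "x \<in> alphabet C" and u: "u \<in> lists (alphabet C)"
      by auto
    show ?case
    proof (cases "delta C (p, x)")
      case None
      then show ?thesis by (simp add: delta[OF p x])
    next
      case (Some r)
      then show ?thesis
        using Cons.IH[OF closed[OF p x Some] u] by (simp add: delta[OF p x])
    qed
  qed simp
  have "(\<exists>n \<in> finals B. run B (start B) u = Some n) \<longleftrightarrow> (\<exists>p \<in> finals C. run C (start C) u = Some p)"
    if "u \<in> lists (alphabet C)" for u
  proof -
    have "start B = f (start C)" "finals B = f ` (P \<inter> finals C)"
      by (simp_all add: B_def)
    then show ?thesis
      using run[OF start that] inj by (cases "run C (start C) u") (auto dest: inj_onD)
  qed
  then have "language B = language C"
    by (auto simp: language_def B_def)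
  moreover have "card (states B) = card P"
    using inj by (simp add: B_def card_image)
  ultimately show ?thesis
    by (intro exI[of _ B]) (simp add: B_def)
qed

section \<open>Orbits of single states\<close>

lemma mem_orbit_singleton_iff:
  "p \<in> orbit A X {q} \<longleftrightarrow> (\<exists>u \<in> lists X. run A q u = Some p)"
  by (simp add: orbit_def)

lemma orbit_refl: "q \<in> orbit A X {q}"
  unfolding mem_orbit_singleton_iff by (rule bexI[of _ "[]"]) auto

lemma orbit_singleton_subset:
  assumes "p \<in> orbit A X {q}"
  shows "orbit A X {p} \<subseteq> orbit A X {q}"
proof
  fix r assume "r \<in> orbit A X {p}"
  then obtain u v where "u \<in> lists X" "run A q u = Some p" "v \<in> lists X" "run A p v = Some r"
    using assms unfolding mem_orbit_singleton_iff by blast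
  then have "u @ v \<in> lists X" "run A q (u @ v) = Some r"
    by (auto simp: run_append)
  then show "r \<in> orbit A X {q}"
    unfolding mem_orbit_singleton_iff by blast
qed

text \<open>Reachability over \<open>X\<close> is symmetric: in a finite permutation group the
  inverse of a map induced by a word over \<open>X\<close> is again induced by a word over
  \<open>X\<close>.\<close>

lemma orbit_singleton_eq:
  assumes A: "permutation_automaton A" and X: "X \<subseteq> alphabet A"
    and q: "q \<in> states A" and p: "p \<in> orbit A X {q}"
  shows "orbit A X {p} = orbit A X {q}"
proof -
  have dfa: "dfa A" using A by (simp add: permutation_automaton_def)
  obtain u where u: "u \<in> lists X" "run A q u = Some p"
    using p unfolding mem_orbit_singleton_iff by blast
  have pA: "p \<in> states A" using run_in_states[OF dfa q u(2)] .
  obtain v where v: "v \<in> lists X" "word_map A (v @ u) = word_map A []"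
    using word_map_left_inverse[OF A X u(1)] by blast
  have uv: "u \<in> lists (alphabet A)" "v \<in> lists (alphabet A)"
    using u v X by auto
  obtain r where r: "r \<in> states A" "run A p v = Some r"
    using run_perm_total[OF A uv(2) pA] by blast
  \<comment> \<open>The word \<open>v\<close> is an inverse acting before \<open>u\<close>, so it is
    applied at \<open>p\<close>: then \<open>u\<close> leads both \<open>r\<close> and
    \<open>q\<close> to \<open>p\<close>, and injectivity identifies them.\<close>
  have "run A r u = Some p"
    using fun_cong[OF v(2), of p] pA r by (simp add: word_map_def run_append)
  then have "r = q"
    using run_perm_inj[OF A uv(1) r(1) q] u by simp
  then have "q \<in> orbit A X {p}"
    using r v unfolding mem_orbit_singleton_iff by blast
  then show ?thesis
    using p orbit_singleton_subset by (metis subset_antisym)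
qed

section \<open>Transitions and runs on orbits\<close>

text \<open>One inclusion holds because \<open>r\<close> is itself a successor of the orbit of
  \<open>q\<close>. The other is where the coset form of normality is used, with the single letter
  \<open>x\<close> as coset representative.\<close>

lemma orbit_image_letter:
  assumes A: "permutation_automaton A" and X: "X \<subseteq> alphabet A"
    and N: "word_map A ` lists X \<lhd> transition_group A"
    and q: "q \<in> states A" and x: "x \<in> alphabet A" and d: "delta A (q, x) = Some r"
  shows "orbit A X {p. \<exists>s \<in> orbit A X {q}. delta A (s, x) = Some p} = orbit A X {r}"
    (is "orbit A X ?S = _")
proof
  have dfa: "dfa A" using A by (simp add: permutation_automaton_def)
  have "r \<in> ?S" using orbit_refl d by fastforce
  then show "orbit A X {r} \<subseteq> orbit A X ?S"
    unfolding orbit_def by blast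
  have "p \<in> orbit A X {r}" if p: "p \<in> ?S" for p
  proof -
    obtain s where s: "s \<in> orbit A X {q}" "delta A (s, x) = Some p"
      using p by blast
    then obtain w where w: "w \<in> lists X" "run A q w = Some s"
      unfolding mem_orbit_singleton_iff by blast
    have "w \<in> lists (alphabet A)" using w X by auto
    then have "\<exists>w' \<in> lists (alphabet A). word_map A w' \<in> word_map A ` lists X \<and>
        word_map A (w @ [x]) = word_map A ([x] @ w')"
      using N[unfolded normal_transition_group_iff[OF A subgroup_word_maps[OF A X]]] w x
      by (metis append_in_lists_conv imageI lists.Nil lists.Cons)
    \<comment> \<open>Normality yields a word over the full alphabet whose map lies in the subgroup;
      it is exchanged for a word over \<open>X\<close> with the same map.\<close>
    then obtain w' where w': "w' \<in> lists X" "word_map A (w @ [x]) = word_map A ([x] @ w')"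
      by (metis (no_types, lifting) image_iff word_map_append[OF dfa])
    have "run A q (w @ [x]) = run A q ([x] @ w')"
      using fun_cong[OF w'(2), of q] q by (simp add: word_map_def)
    then have "run A r w' = Some p"
      using w s d by (simp add: run_append)
    then show ?thesis
      using w' unfolding mem_orbit_singleton_iff by blast
  qed
  then show "orbit A X ?S \<subseteq> orbit A X {r}"
    using orbit_singleton_subset[of _ A X r] unfolding orbit_def by blast
qed

lemma orbit_subset_states:
  assumes "dfa A" "S \<subseteq> states A"
  shows "orbit A X S \<subseteq> states A"
  using run_in_states[OF assms(1)] assms(2) by (auto simp: orbit_def)

lemma delta_projection_automaton:
  assumes A: "permutation_automaton A" and \<Gamma>: "\<Gamma> \<subseteq> alphabet A"
    and N: "word_map A ` lists (alphabet A - \<Gamma>) \<lhd> transition_group A"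
    and q: "q \<in> states A" and x: "x \<in> \<Gamma>" and d: "delta A (q, x) = Some r"
  shows "delta (projection_automaton A \<Gamma>) (orbit A (alphabet A - \<Gamma>) {q}, x) =
    Some (orbit A (alphabet A - \<Gamma>) {r})"
proof -
  have "dfa A" using A by (simp add: permutation_automaton_def)
  then have "orbit A (alphabet A - \<Gamma>) {q} \<subseteq> states A"
    using q by (intro orbit_subset_states) auto
  moreover have "x \<in> alphabet A" using x \<Gamma> by blast
  ultimately show ?thesis
    using orbit_image_letter[OF A _ N q _ d] x
    by (simp add: projection_automaton_def Let_def)
qed

text \<open>A letter of \<Gamma> moves both automata in step; any other letter is erased by the
  projection and moves \<open>A\<close> within the current orbit.\<close>

lemma run_projection_automaton:
  assumes A: "permutation_automaton A" and \<Gamma>: "\<Gamma> \<subseteq> alphabet A"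
    and N: "word_map A ` lists (alphabet A - \<Gamma>) \<lhd> transition_group A"
    and q: "q \<in> states A" and u: "u \<in> lists (alphabet A)" and r: "run A q u = Some r"
  shows "run (projection_automaton A \<Gamma>) (orbit A (alphabet A - \<Gamma>) {q}) (projection \<Gamma> u) =
    Some (orbit A (alphabet A - \<Gamma>) {r})"
  using q u r
proof (induction u arbitrary: q rule: list.induct)
  case (Cons x u)
  have x: "x \<in> alphabet A" and u: "u \<in> lists (alphabet A)" using Cons.prems by auto
  obtain p where p: "delta A (q, x) = Some p" "p \<in> states A"
    using perm_delta[OF A x Cons.prems(1)] .
  have IH: "run (projection_automaton A \<Gamma>) (orbit A (alphabet A - \<Gamma>) {p}) (projection \<Gamma> u) =
      Some (orbit A (alphabet A - \<Gamma>) {r})"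
    using Cons.IH[OF p(2) u] Cons.prems(3) p by simp
  show ?case
  proof (cases "x \<in> \<Gamma>")
    case True
    then show ?thesis
      using IH delta_projection_automaton[OF A \<Gamma> N Cons.prems(1) True p(1)]
      by (simp add: projection_def)
  next
    case False
    then have "[x] \<in> lists (alphabet A - \<Gamma>)" "run A q [x] = Some p" using x p by auto
    then have "p \<in> orbit A (alphabet A - \<Gamma>) {q}"
      unfolding mem_orbit_singleton_iff by blast
    then show ?thesis
      using IH False orbit_singleton_eq[OF A _ Cons.prems(1)] by (simp add: projection_def)
  qed
qed (simp add: projection_def)

section \<open>Reachable orbits and the projected language\<close>

lemma projection_in_lists: "u \<in> lists X \<Longrightarrow> projection \<Gamma> u \<in> lists \<Gamma>"
  by (auto simp: projection_def)

lemma projection_lists_id: "u \<in> lists \<Gamma> \<Longrightarrow> projection \<Gamma> u = u"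
  by (auto simp: projection_def)

lemma projection_append: "projection \<Gamma> (u @ v) = projection \<Gamma> u @ projection \<Gamma> v"
  by (simp add: projection_def)

lemma projection_lists_diff: "u \<in> lists (X - \<Gamma>) \<Longrightarrow> projection \<Gamma> u = []"
  by (auto simp: projection_def)

lemma projection_automaton_simps:
  "alphabet (projection_automaton A \<Gamma>) = \<Gamma>"
  "start (projection_automaton A \<Gamma>) = orbit A (alphabet A - \<Gamma>) {start A}"
  "finals (projection_automaton A \<Gamma>) = {T. T \<subseteq> states A \<and> T \<inter> finals A \<noteq> {}}"
  by (simp_all add: projection_automaton_def Let_def)

text \<open>A word over \<Gamma> is its own projection, so it leads to the orbit of the state that
  \<open>A\<close> reaches on it; conversely, a run of \<open>A\<close> on any word projects to a
  run between orbits.\<close>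

lemma reachable_projection_automaton:
  assumes A: "permutation_automaton A" and \<Gamma>: "\<Gamma> \<subseteq> alphabet A"
    and N: "word_map A ` lists (alphabet A - \<Gamma>) \<lhd> transition_group A"
  shows "orbit (projection_automaton A \<Gamma>) \<Gamma> {start (projection_automaton A \<Gamma>)} =
    (\<lambda>q. orbit A (alphabet A - \<Gamma>) {q}) ` orbit A (alphabet A) {start A}"
    (is "?L = ?R")
proof
  have q0: "start A \<in> states A"
    using A by (simp add: permutation_automaton_def dfa_def)
  note run = run_projection_automaton[OF A \<Gamma> N q0]
  show "?L \<subseteq> ?R"
  proof
    fix T assume "T \<in> ?L"
    then obtain u where u: "u \<in> lists \<Gamma>"
      "run (projection_automaton A \<Gamma>) (start (projection_automaton A \<Gamma>)) u = Some T"
      unfolding mem_orbit_singleton_iff by blast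
    have uA: "u \<in> lists (alphabet A)" using u \<Gamma> by auto
    obtain r where r: "run A (start A) u = Some r"
      using run_perm_total[OF A uA q0] by blast
    have "T = orbit A (alphabet A - \<Gamma>) {r}"
      using run[OF uA r] u by (simp add: projection_lists_id projection_automaton_simps)
    moreover have "r \<in> orbit A (alphabet A) {start A}"
      using uA r unfolding mem_orbit_singleton_iff by blast
    ultimately show "T \<in> ?R" by blast
  qed
  show "?R \<subseteq> ?L"
  proof (rule image_subsetI)
    fix r assume "r \<in> orbit A (alphabet A) {start A}"
    then obtain u where u: "u \<in> lists (alphabet A)" "run A (start A) u = Some r"
      unfolding mem_orbit_singleton_iff by blast
    \<comment> \<open>The witness \<open>projection \<Gamma> u\<close> is found by unification with
      \<open>run\<close>.\<close>
    show "orbit A (alphabet A - \<Gamma>) {r} \<in> ?L"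
      unfolding mem_orbit_singleton_iff projection_automaton_simps
      by (rule bexI, rule run[OF u]) (rule projection_in_lists[OF u(1)])
  qed
qed

text \<open>Two orbits with a common state both equal the orbit of that state.\<close>

lemma partition_on_orbits:
  assumes A: "permutation_automaton A" and X: "X \<subseteq> alphabet A"
  shows "partition_on (states A) ((\<lambda>q. orbit A X {q}) ` states A)"
proof (rule partition_onI)
  have "dfa A" using A by (simp add: permutation_automaton_def)
  then show "\<Union> ((\<lambda>q. orbit A X {q}) ` states A) = states A"
    using orbit_refl[of _ A X] orbit_subset_states[of A "{_}" X] by blast
next
  show "{} \<notin> (\<lambda>q. orbit A X {q}) ` states A"
    using orbit_refl by fastforce
  show "disjnt S T" if "S \<in> (\<lambda>q. orbit A X {q}) ` states A" "T \<in> (\<lambda>q. orbit A X {q}) ` states A"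
    "S \<noteq> T" for S T
    using that orbit_singleton_eq[OF A X] unfolding disjnt_def by blast
qed

text \<open>If the orbit reached on \<open>v\<close> meets the final states, a word \<open>w\<close>
  of erased letters completes \<open>v\<close> to an accepted word that still projects to
  \<open>v\<close>. Conversely, an accepting state of \<open>A\<close> lies in its own
  orbit.\<close>

lemma language_projection_automaton:
  assumes A: "permutation_automaton A" and \<Gamma>: "\<Gamma> \<subseteq> alphabet A"
    and N: "word_map A ` lists (alphabet A - \<Gamma>) \<lhd> transition_group A"
  shows "language (projection_automaton A \<Gamma>) = projection \<Gamma> ` language A"
proof
  have dfa: "dfa A" and q0: "start A \<in> states A"
    using A by (simp_all add: permutation_automaton_def dfa_def)
  note run = run_projection_automaton[OF A \<Gamma> N q0]
  show "language (projection_automaton A \<Gamma>) \<subseteq> projection \<Gamma> ` language A"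
  proof
    fix v assume "v \<in> language (projection_automaton A \<Gamma>)"
    then obtain T where v: "v \<in> lists \<Gamma>" and T: "T \<inter> finals A \<noteq> {}"
      "run (projection_automaton A \<Gamma>) (orbit A (alphabet A - \<Gamma>) {start A}) v = Some T"
      by (auto simp: language_def projection_automaton_simps)
    have vA: "v \<in> lists (alphabet A)" using v \<Gamma> by auto
    obtain r where r: "run A (start A) v = Some r"
      using run_perm_total[OF A vA q0] by blast
    have "T = orbit A (alphabet A - \<Gamma>) {r}"
      using run[OF vA r] T v by (simp add: projection_lists_id)
    then obtain w p where w: "w \<in> lists (alphabet A - \<Gamma>)" "run A r w = Some p" "p \<in> finals A"
      using T(1) unfolding orbit_def by blast
    have "v @ w \<in> lists (alphabet A)" using vA w by auto
    moreover have "run A (start A) (v @ w) = Some p" using r w by (simp add: run_append)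
    ultimately have "v @ w \<in> language A" using w(3) by (auto simp: language_def)
    moreover have "projection \<Gamma> (v @ w) = v"
      using v w by (simp add: projection_append projection_lists_id projection_lists_diff)
    ultimately show "v \<in> projection \<Gamma> ` language A" by (metis imageI)
  qed
  show "projection \<Gamma> ` language A \<subseteq> language (projection_automaton A \<Gamma>)"
  proof (rule image_subsetI)
    fix u assume "u \<in> language A"
    then obtain p where u: "u \<in> lists (alphabet A)" "p \<in> finals A" "run A (start A) u = Some p"
      by (auto simp: language_def)
    have "p \<in> states A" using u(2) dfa by (auto simp: dfa_def)
    then have "orbit A (alphabet A - \<Gamma>) {p} \<in> finals (projection_automaton A \<Gamma>)"
      using orbit_subset_states[OF dfa, of "{p}"] orbit_refl[of p A] u(2)
      by (auto simp: projection_automaton_simps)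
    then show "projection \<Gamma> u \<in> language (projection_automaton A \<Gamma>)"
      using run[OF u(1,3)] projection_in_lists[OF u(1)]
      by (simp add: language_def projection_automaton_simps(1,2))
  qed
qed

section \<open>The state partition and the bound on the number of states\<close>

theorem theorem11:
  fixes A :: "('q, 'a) automaton" and \<Gamma> \<Delta> :: "'a set" and N :: "('q \<rightharpoonup> 'q) set"
  assumes "permutation_automaton A"
    and "\<Gamma> \<subseteq> alphabet A"
    and "\<Delta> = alphabet A - \<Gamma>"
    and "N = {word_map A u | u. u \<in> lists \<Delta>}"
    and "N \<lhd> transition_group A"
  shows "(accessible A \<longrightarrow> state_partition_automaton A \<Gamma>) \<and>
    (\<exists>B :: (nat, 'a) automaton.
       dfa B \<and> alphabet B = \<Gamma> \<and> card (states B) \<le> card (states A) \<and>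
       language B = projection \<Gamma> ` language A)"
proof
  let ?R = "projection_automaton A \<Gamma>"
  let ?P = "(\<lambda>q. orbit A (alphabet A - \<Gamma>) {q}) ` states A"
  note A = assms(1) and \<Gamma> = assms(2)
  have "N = word_map A ` lists (alphabet A - \<Gamma>)"
    using assms(3,4) by blast
  then have N: "word_map A ` lists (alphabet A - \<Gamma>) \<lhd> transition_group A"
    using assms(5) by simp
  have fin: "finite (states A)" "finite \<Gamma>" and q0: "start A \<in> states A"
    using A \<Gamma> finite_subset by (auto simp: permutation_automaton_def dfa_def)
  \<comment> \<open>Accessibility makes the family of reachable orbits range over all of
    \<open>states A\<close>, which is the family shown to be a partition.\<close>
  show "accessible A \<longrightarrow> state_partition_automaton A \<Gamma>"
    using reachable_projection_automaton[OF A \<Gamma> N] partition_on_orbits[OF A, of "alphabet A - \<Gamma>"]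
    by (simp add: accessible_def state_partition_automaton_def Let_def projection_automaton_simps(1))
  \<comment> \<open>As an image of \<open>states A\<close>, the set \<open>?P\<close> has at most
    \<open>card (states A)\<close> elements; closure under transitions lets it serve as the state
    set of \<open>B\<close>.\<close>
  have closed: "T \<in> ?P" if S: "S \<in> ?P" and x: "x \<in> \<Gamma>" and T: "delta ?R (S, x) = Some T" for S x T
  proof -
    obtain q where q: "q \<in> states A" "S = orbit A (alphabet A - \<Gamma>) {q}"
      using S by blast
    obtain r where r: "delta A (q, x) = Some r" "r \<in> states A"
      using perm_delta[OF A _ q(1)] x \<Gamma> by blast
    have "T = orbit A (alphabet A - \<Gamma>) {r}"
      using delta_projection_automaton[OF A \<Gamma> N q(1) x r(1)] T q(2) by simp
    then show ?thesis
      using r(2) by blast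
  qed
  have "\<exists>B :: (nat, 'a) automaton. dfa B \<and> alphabet B = alphabet ?R \<and>
      card (states B) = card ?P \<and> language B = language ?R"
    unfolding projection_automaton_simps(1)
    by (rule nat_dfa_of_closed_states[of ?P ?R, unfolded projection_automaton_simps(1,2)])
      (use fin q0 in \<open>blast intro: closed\<close>)+
  then obtain B :: "(nat, 'a) automaton" where
    "dfa B" "alphabet B = \<Gamma>" "card (states B) = card ?P" "language B = language ?R"
    unfolding projection_automaton_simps(1) by blast
  moreover have "card ?P \<le> card (states A)"
    using fin(1) by (rule card_image_le)
  ultimately show "\<exists>B :: (nat, 'a) automaton.
      dfa B \<and> alphabet B = \<Gamma> \<and> card (states B) \<le> card (states A) \<and>
      language B = projection \<Gamma> ` language A"
    using language_projection_automaton[OF A \<Gamma> N] by (intro exI[of _ B]) simp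
qed

end
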